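(* Under the $L^2$ Wasserstein loss, any predictive density $\hat{p}(y\mid x)$ with mean $\hat{\mu}(x)$ is dominated by the plug-in density $p(y\mid\hat{\mu}(x))=f(y-\hat{\mu}(x))$. That is, writing $\hat{p}_{\mathrm{plug}}(y\mid x)=p(y\mid\hat{\mu}(x))$, one has $R(\mu,\hat{p}_{\mathrm{plug}})\le R(\mu,\hat{p})$ for every $\mu\in\mathbb{R}^d$, and $R(\mu,\hat{p}_{\mathrm{plug}})<R(\mu,\hat{p})$ for some $\mu\in\mathbb{R}^d$.
   Context: Let $f:\mathbb{R}^d\to[0,\infty)$ satisfy $\int f(z)\,\mathrm{d}z=1$ and $\int z f(z)\,\mathrm{d}z=0$ and have finite second moments, and let $p(z\mid\mu)=f(z-\mu)$, $\mu\in\mathbb{R}^d$, be the associated location family. An observation $x\sim p(x\mid\mu)$ is used to predict $y\sim p(y\mid\mu)$, with $\mu$ unknown. A predictive density $\hat{p}(y\mid x)$ is, for each $x$, a probability density in $y\in\mathbb{R}^d$. Attention is restricted to predictive densities with finite mean $\hat{\mu}(x)=\int y\,\hat{p}(y\mid x)\,\mathrm{d}y$, since the loss would diverge otherwise. For probability distributions $p_1,p_2$ on $\mathbb{R}^d$, $W_2(p_1,p_2)=\inf_{X,Y}\mathrm{E}[\|X-Y\|^2]^{1/2}$, the infimum being over all joint distributions of $(X,Y)$ with marginals $p_1$ and $p_2$. The $L^2$ Wasserstein loss is $W_2(p(y\mid\mu),\hat{p}(y\mid x))^2$, and the risk is $R(\mu,\hat{p})=\int W_2(p(y\mid\mu),\hat{p}(y\mid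 x))^2\,p(x\mid\mu)\,\mathrm{d}x$. A predictive density $\hat{p}_1$ is said to dominate $\hat{p}_2$ if $R(\mu,\hat{p}_1)\le R(\mu,\hat{p}_2)$ for every $\mu$ and $R(\mu,\hat{p}_1)<R(\mu,\hat{p}_2)$ for some $\mu$.
   Formalization: Strict inequality fails if p̂ is its own plug-in, e.g. p̂(y|x)=f(y−x), or if all plug-in risks are infinite; it is proved when at some μ the plug-in risk is finite and p̂ differs from the plug-in with positive p(x|μ)-probability. R(μ,p̂_plug) ≤ R(μ,p̂) is unconditional. *)

theory Defs
  imports "HOL-Probability.Probability"
begin

text \<open>
  Euclidean $d$-space is an arbitrary type of class \<^class>\<open>euclidean_space\<close>.  Loss and risk take
  values in \<^typ>\<open>ennreal\<close>, because neither need be finite.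
\<close>

definition is_density :: "('a::euclidean_space \<Rightarrow> real) \<Rightarrow> bool" where
  "is_density g \<longleftrightarrow>
     g \<in> borel_measurable borel \<and> (\<forall>z. 0 \<le> g z) \<and>
     integrable lborel g \<and> (LINT z|lborel. g z) = 1"

definition dist_of :: "('a::euclidean_space \<Rightarrow> real) \<Rightarrow> 'a measure" where
  "dist_of g = density lborel (\<lambda>z. ennreal (g z))"

definition location_density :: "('a::euclidean_space \<Rightarrow> real) \<Rightarrow> 'a \<Rightarrow> 'a \<Rightarrow> real" where
  "location_density f \<mu> z = f (z - \<mu>)"

text \<open>
  A predictive density $\hat p(y \mid x)$ is the curried function \<open>p x y\<close>, observation first.
  Joint measurability is what makes it a Markov kernel, so that the risk is meaningful.
\<close>

definition predictive_density :: "('a::euclidean_space \<Rightarrow> 'a \<Rightarrow> real) \<Rightarrow> bool" where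
  "predictive_density p \<longleftrightarrow>
     (\<lambda>(x, y). p x y) \<in> borel_measurable (borel \<Otimes>\<^sub>M borel) \<and> (\<forall>x. is_density (p x))"

definition has_finite_mean :: "('a::euclidean_space \<Rightarrow> real) \<Rightarrow> bool" where
  "has_finite_mean g \<longleftrightarrow> integrable lborel (\<lambda>y. g y *\<^sub>R y)"

definition density_mean :: "('a::euclidean_space \<Rightarrow> real) \<Rightarrow> 'a" where
  "density_mean g = (LINT y|lborel. g y *\<^sub>R y)"

definition plug_in ::
    "('a::euclidean_space \<Rightarrow> real) \<Rightarrow> ('a \<Rightarrow> 'a \<Rightarrow> real) \<Rightarrow> 'a \<Rightarrow> 'a \<Rightarrow> real" where
  "plug_in f p x = location_density f (density_mean (p x))"

definition couplings ::
    "'a::euclidean_space measure \<Rightarrow> 'a measure \<Rightarrow> ('a \<times> 'a) measure set" where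
  "couplings P Q =
     {M. prob_space M \<and> sets M = sets (borel \<Otimes>\<^sub>M borel) \<and>
         distr M borel fst = P \<and> distr M borel snd = Q}"

definition ennreal_sqrt :: "ennreal \<Rightarrow> ennreal" where
  "ennreal_sqrt a = (if a = \<top> then \<top> else ennreal (sqrt (enn2real a)))"

definition wasserstein2 :: "'a::euclidean_space measure \<Rightarrow> 'a measure \<Rightarrow> ennreal" where
  "wasserstein2 P Q =
     (INF M \<in> couplings P Q. ennreal_sqrt (\<integral>\<^sup>+ (u, v). ennreal ((norm (u - v))\<^sup>2) \<partial>M))"

definition risk ::
    "('a::euclidean_space \<Rightarrow> real) \<Rightarrow> 'a \<Rightarrow> ('a \<Rightarrow> 'a \<Rightarrow> real) \<Rightarrow> ennreal" where
  "risk f \<mu> p =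
     (\<integral>\<^sup>+ x. (wasserstein2 (dist_of (location_density f \<mu>)) (dist_of (p x)))\<^sup>2
            * ennreal (location_density f \<mu> x) \<partial>lborel)"

definition dominates ::
    "('a::euclidean_space \<Rightarrow> real) \<Rightarrow> ('a \<Rightarrow> 'a \<Rightarrow> real) \<Rightarrow> ('a \<Rightarrow> 'a \<Rightarrow> real) \<Rightarrow> bool" where
  "dominates f p q \<longleftrightarrow>
     (\<forall>\<mu>. risk f \<mu> p \<le> risk f \<mu> q) \<and> (\<exists>\<mu>. risk f \<mu> p < risk f \<mu> q)"

text \<open>
  No density dominates itself, and none is dominated when its competitor has infinite risk
  everywhere.  The strict part of a domination result therefore has to exclude predictive densities
  that coincide with their own plug-in density, densities being identified when they are equal
  almost everywhere, and to ask for finite risk.  Here \<open>M\<close> is the reference measure for the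
  observation.
\<close>

definition coincide ::
    "'a::euclidean_space measure \<Rightarrow> ('a \<Rightarrow> 'a \<Rightarrow> real) \<Rightarrow> ('a \<Rightarrow> 'a \<Rightarrow> real) \<Rightarrow> bool" where
  "coincide M p q \<longleftrightarrow> (AE x in M. AE y in lborel. p x y = q x y)"

end

theory Submission
  imports Defs
begin

text \<open>
  If $U$ and $V$ have means $a$ and $b$ and $d = a - b$, then
  $E\|U - V\|^2 = \|d\|^2 + E\|(U - d) - V\|^2$.  So no predictive density with mean
  $\hat\mu(x)$ has loss below $\|\mu - \hat\mu(x)\|^2$, and the plug-in density attains this
  through the translation coupling.  For strictness the excess $E\|(U - d) - V\|^2$ is bounded
  below by $(E\,\varphi(U - d) - E\,\varphi(V))^2$ with $\varphi$ 1-Lipschitz and bounded.  Unlike the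
  Wasserstein distance this bound is visibly measurable in $x$, and countably many $\varphi$ suffice
  to separate distributions, so some $\varphi$ gives a gap on a set of $x$ that is not null.  A set
  that is null under every translate of $f$ is Lebesgue null by Fubini.
\<close>

section \<open>A countable family of bounded Lipschitz test functions that separates probability
  measures\<close>

lemma lipschitz_on_min_infdist: "1-lipschitz_on UNIV (\<lambda>x. min c (infdist x S))"
proof (rule lipschitz_onI)
  fix x y :: 'a
  show "dist (min c (infdist x S)) (min c (infdist y S)) \<le> 1 * dist x y"
    using infdist_triangle_abs[of x S y] unfolding dist_real_def by linarith
qed simp

text \<open>Closing a countable base under finite intersections keeps it countable and turns it into
  a pi-system of open sets, so two probability measures need only be compared on these sets.\<close>

lemma borel_eq_sigma_finite_Inter_basis:
  fixes B :: "'a::second_countable_topology set set"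
  assumes B: "countable B" "topological_basis B"
  shows "sets borel = sigma_sets UNIV (Inter ` {F. finite F \<and> F \<subseteq> B})" (is "_ = sigma_sets UNIV ?E")
proof
  have "B \<subseteq> ?E"
    by (auto intro!: image_eqI[where x = "{_}"])
  then have "sigma_sets UNIV B \<subseteq> sigma_sets UNIV ?E"
    by (intro sigma_sets_mono') auto
  then show "sets borel \<subseteq> sigma_sets UNIV ?E"
    by (simp add: borel_eq_countable_basis[OF B])
  have "?E \<subseteq> sets borel"
    using topological_basis_open[OF B(2)] by (auto intro!: borel_open open_Inter)
  then show "sigma_sets UNIV ?E \<subseteq> sets borel"
    using sets.sigma_sets_subset[of ?E borel] by simp
qed

text \<open>The distance to the closed set \<open>- U\<close> is positive exactly on
  \<open>U\<close>, so the scaled truncations tend to the indicator of \<open>U\<close>, dominated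
  by 1. Truncating at \<open>1 / real (Suc n)\<close> and keeping the factor outside the integral
  leaves an integrand that is 1-Lipschitz. The case \<open>U = UNIV\<close> is excluded because
  \<open>infdist\<close> to the empty set is 0 by convention, and the limit would be 0.\<close>

lemma measure_open_limit_lipschitz:
  fixes P :: "'a::metric_space measure"
  assumes P: "finite_measure P" "sets P = sets borel" and U: "open U" "U \<noteq> UNIV"
  shows "(\<lambda>n. real (Suc n) * (\<integral>x. min (1 / real (Suc n)) (infdist x (- U)) \<partial>P))
    \<longlonglongrightarrow> measure P U"
proof -
  interpret finite_measure P by fact
  have [measurable_cong]: "sets P = sets borel" by fact
  have [measurable]: "U \<in> sets borel" "(\<lambda>x. infdist x (- U)) \<in> borel_measurable borel"
    using U(1) by (auto intro!: borel_measurable_continuous_onI continuous_intros)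
  have "(\<lambda>n. \<integral>x. real (Suc n) * min (1 / real (Suc n)) (infdist x (- U)) \<partial>P)
      \<longlonglongrightarrow> (\<integral>x. indicator U x \<partial>P)"
  proof (rule integral_dominated_convergence[where w = "\<lambda>_. 1"])
    show "AE x in P. (\<lambda>n. real (Suc n) * min (1 / real (Suc n)) (infdist x (- U))) \<longlonglongrightarrow> indicator U x"
    proof (rule AE_I2)
      fix x
      show "(\<lambda>n. real (Suc n) * min (1 / real (Suc n)) (infdist x (- U))) \<longlonglongrightarrow> indicator U x"
      proof (cases "x \<in> U")
        case True
        then have pos: "0 < infdist x (- U)"
          using U by (intro infdist_pos_not_in_closed) auto
        have "eventually (\<lambda>n. 1 / real (Suc n) < infdist x (- U)) sequentially"
          using order_tendstoD(2)[OF lim_inverse_n' pos]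
          by (subst eventually_sequentially_Suc)
        then have "eventually (\<lambda>n. real (Suc n) * min (1 / real (Suc n)) (infdist x (- U)) = 1) sequentially"
          by eventually_elim (simp add: min_def)
        then show ?thesis
          using True by (simp add: tendsto_eventually)
      next
        case False
        then show ?thesis by (simp add: min_def)
      qed
    qed
    show "AE x in P. norm (real (Suc n) * min (1 / real (Suc n)) (infdist x (- U))) \<le> 1" for n
    proof (rule AE_I2)
      fix x
      have "real (Suc n) * min (1 / real (Suc n)) (infdist x (- U)) \<le> real (Suc n) * (1 / real (Suc n))"
        by (intro mult_left_mono) auto
      moreover have "0 \<le> min (1 / real (Suc n)) (infdist x (- U))"
        by (simp add: infdist_nonneg)
      ultimately show "norm (real (Suc n) * min (1 / real (Suc n)) (infdist x (- U))) \<le> 1"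
        by (simp add: abs_mult)
    qed
  qed auto
  then show ?thesis by simp
qed

text \<open>The truncated distances to complements of the sets in a countable pi-system recover the
  measures of those sets as limits. Countability is what later allows "for every test function, for
  almost every x" to be turned into "for almost every x, for every test function".\<close>

lemma countable_lipschitz_family_determines_prob:
  obtains F :: "('a::{second_countable_topology, metric_space} \<Rightarrow> real) set"
  where "countable F" "\<And>\<phi>. \<phi> \<in> F \<Longrightarrow> 1-lipschitz_on UNIV \<phi>" "\<And>\<phi>. \<phi> \<in> F \<Longrightarrow> bounded (range \<phi>)"
    "\<And>P Q. prob_space P \<Longrightarrow> prob_space Q \<Longrightarrow> sets P = sets borel \<Longrightarrow> sets Q = sets borel \<Longrightarrow>
      (\<And>\<phi>. \<phi> \<in> F \<Longrightarrow> (\<integral>x. \<phi> x \<partial>P) = (\<integral>x. \<phi> x \<partial>Q)) \<Longrightarrow> P = Q"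
proof -
  obtain B :: "'a set set" where B: "countable B" "topological_basis B"
    using ex_countable_basis by blast
  define E where "E = Inter ` {F. finite F \<and> F \<subseteq> B}"
  define \<phi> where "\<phi> U n x = min (1 / real (Suc n)) (infdist x (- U))" for U :: "'a set" and n x
  define F where "F = case_prod \<phi> ` (E \<times> UNIV)"
  have "countable {F. finite F \<and> F \<subseteq> B}"
    using B(1) by (simp add: countable_Collect_finite_subset conj_commute)
  then have "countable F"
    unfolding F_def E_def by simp
  moreover have "1-lipschitz_on UNIV \<psi>" if "\<psi> \<in> F" for \<psi>
    using that lipschitz_on_min_infdist unfolding F_def \<phi>_def by auto
  moreover have "bounded (range \<psi>)" if \<psi>: "\<psi> \<in> F" for \<psi>
  proof -
    obtain U n where "\<psi> = \<phi> U n"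
      using \<psi> by (auto simp: F_def)
    then have "range \<psi> \<subseteq> {0..1 / real (Suc n)}"
      by (auto simp: \<phi>_def infdist_nonneg)
    then show ?thesis
      by (rule bounded_subset[OF bounded_closed_interval])
  qed
  moreover have "P = Q" if PQ: "prob_space P" "prob_space Q" "sets P = sets borel" "sets Q = sets borel"
    and eq: "\<And>\<phi>. \<phi> \<in> F \<Longrightarrow> (\<integral>x. \<phi> x \<partial>P) = (\<integral>x. \<phi> x \<partial>Q)" for P Q
  proof (rule measure_eqI_generator_eq_countable[where E = E and \<Omega> = UNIV and A = "{UNIV}"])
    interpret P: prob_space P by fact
    interpret Q: prob_space Q by fact
    show "Int_stable E"
    proof (rule Int_stableI)
      fix a b assume "a \<in> E" "b \<in> E"
      then obtain S T where "finite S" "S \<subseteq> B" "a = \<Inter>S" "finite T" "T \<subseteq> B" "b = \<Inter>T"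
        by (auto simp: E_def)
      then show "a \<inter> b \<in> E"
        unfolding E_def by (intro image_eqI[where x = "S \<union> T"]) auto
    qed
    show "emeasure P U = emeasure Q U" if "U \<in> E" for U
    \<comment> \<open>The empty intersection puts \<open>UNIV\<close> into \<open>E\<close>. There
      the truncated distances vanish and carry no information, but both total masses are 1.\<close>
    proof (cases "U = UNIV")
      case True
      then show ?thesis
        using P.emeasure_space_1 Q.emeasure_space_1 PQ(3,4)[THEN sets_eq_imp_space_eq] by simp
    next
      case False
      have U: "open U"
        using \<open>U \<in> E\<close> topological_basis_open[OF B(2)] by (auto simp: E_def intro!: open_Inter)
      have "(\<lambda>n. real (Suc n) * (\<integral>x. \<phi> U n x \<partial>P)) \<longlonglongrightarrow> measure P U"
        "(\<lambda>n. real (Suc n) * (\<integral>x. \<phi> U n x \<partial>Q)) \<longlonglongrightarrow> measure Q U"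
        unfolding \<phi>_def using PQ U False
        by (auto intro!: measure_open_limit_lipschitz P.finite_measure_axioms Q.finite_measure_axioms simp del: of_nat_Suc)
      moreover have "(\<integral>x. \<phi> U n x \<partial>P) = (\<integral>x. \<phi> U n x \<partial>Q)" for n
        using \<open>U \<in> E\<close> by (intro eq) (auto simp: F_def)
      ultimately have "measure P U = measure Q U"
        using LIMSEQ_unique by auto
      then show ?thesis
        by (simp add: P.emeasure_eq_measure Q.emeasure_eq_measure)
    qed
    show "sets P = sigma_sets UNIV E" "sets Q = sigma_sets UNIV E"
      unfolding E_def borel_eq_sigma_finite_Inter_basis[OF B, symmetric] using PQ by auto
    show "{UNIV} \<subseteq> E"
      by (auto simp: E_def intro!: image_eqI[where x = "{}"])
    show "\<And>a. a \<in> {UNIV} \<Longrightarrow> emeasure P a \<noteq> \<infinity>" by simp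
  qed auto
  ultimately show ?thesis
    by (rule that)
qed

section \<open>Bounds for the transport cost and the squared Wasserstein distance\<close>

text \<open>The difference of the two coordinates is \<open>d\<close> plus a centred variable
  \<open>Z\<close>. The cross term integrates to zero, which leaves |d|^2 + E|Z|^2. Then E|Z|^2 >=
  (E|Z|)^2, and |Z| dominates the difference of the values of \<open>\<phi>\<close> at the shifted
  first coordinate and at the second.\<close>

lemma coupling_cost_lower_bound:
  fixes P Q :: "'a::euclidean_space measure"
  assumes M: "M \<in> couplings P Q"
    and P: "integrable P (\<lambda>u. u)" and Q: "integrable Q (\<lambda>v. v)"
    and \<phi>: "1-lipschitz_on UNIV \<phi>" "bounded (range \<phi>)"
  defines "d \<equiv> (\<integral>u. u \<partial>P) - (\<integral>v. v \<partial>Q)"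
  shows "ennreal ((norm d)\<^sup>2 + ((\<integral>u. \<phi> (u - d) \<partial>P) - (\<integral>v. \<phi> v \<partial>Q))\<^sup>2)
    \<le> (\<integral>\<^sup>+ (u, v). ennreal ((norm (u - v))\<^sup>2) \<partial>M)"
\<comment> \<open>An infinite cost makes the bound trivial. A finite one provides the square
  integrability that allows work with real integrals.\<close>
proof (cases "(\<integral>\<^sup>+ (u, v). ennreal ((norm (u - v))\<^sup>2) \<partial>M) = \<top>")
  case True
  then show ?thesis by simp
next
  case False
  have M': "prob_space M" "sets M = sets (borel \<Otimes>\<^sub>M borel)"
    and P_eq: "P = distr M borel fst" and Q_eq: "Q = distr M borel snd"
    using M by (auto simp: couplings_def)
  interpret prob_space M by fact
  have [measurable_cong]: "sets M = sets (borel \<Otimes>\<^sub>M borel)" by fact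
  have [measurable]: "\<phi> \<in> borel_measurable borel"
    using lipschitz_on_continuous_on[OF \<phi>(1)] by (rule borel_measurable_continuous_onI)
  obtain C where C: "\<And>x. norm (\<phi> x) \<le> C"
    using \<phi>(2) by (auto simp: bounded_iff)
  define Z where "Z w = fst w - snd w - d" for w :: "'a \<times> 'a"
  have [measurable]: "Z \<in> borel_measurable M"
    unfolding Z_def by measurable
  have int_fs: "integrable M fst" "integrable M snd"
    using integrable_distr[OF _ P[unfolded P_eq]] integrable_distr[OF _ Q[unfolded Q_eq]] by simp_all
  have int_Z: "integrable M Z"
    unfolding Z_def using int_fs by auto
  have d: "d = (\<integral>w. fst w \<partial>M) - (\<integral>w. snd w \<partial>M)"
    unfolding d_def P_eq Q_eq by (subst (1 2) integral_distr) auto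
  have EZ: "(\<integral>w. Z w \<partial>M) = 0"
    unfolding Z_def using int_fs by (simp add: d prob_space)
  have expand: "(norm (fst w - snd w))\<^sup>2 = (norm (Z w))\<^sup>2 + 2 * (Z w \<bullet> d) + (norm d)\<^sup>2" for w
    by (simp add: Z_def power2_norm_eq_inner algebra_simps inner_commute)
  have int_sq: "integrable M (\<lambda>w. (norm (fst w - snd w))\<^sup>2)"
    using False by (intro integrableI_bounded) (auto simp: case_prod_unfold less_top)
  have int_Z2: "integrable M (\<lambda>w. (norm (Z w))\<^sup>2)"
  proof (rule Bochner_Integration.integrable_cong[THEN iffD1])
    show "integrable M (\<lambda>w. (norm (fst w - snd w))\<^sup>2 - 2 * (Z w \<bullet> d) - (norm d)\<^sup>2)"
      using int_sq int_Z by auto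
  qed (auto simp: expand)
  have "(\<integral>w. (norm (fst w - snd w))\<^sup>2 \<partial>M) = (\<integral>w. (norm (Z w))\<^sup>2 \<partial>M) + (norm d)\<^sup>2"
    unfolding expand using int_Z2 int_Z EZ by (simp add: prob_space)
  moreover have "((\<integral>u. \<phi> (u - d) \<partial>P) - (\<integral>v. \<phi> v \<partial>Q))\<^sup>2 \<le> (\<integral>w. (norm (Z w))\<^sup>2 \<partial>M)"
  proof -
    have int_\<phi>: "integrable M (\<lambda>w. \<phi> (fst w - d))" "integrable M (\<lambda>w. \<phi> (snd w))"
      by (intro integrable_const_bound[where B = C]; auto intro!: C[simplified])+
    have "\<bar>(\<integral>u. \<phi> (u - d) \<partial>P) - (\<integral>v. \<phi> v \<partial>Q)\<bar> = \<bar>\<integral>w. \<phi> (fst w - d) - \<phi> (snd w) \<partial>M\<bar>"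
      using int_\<phi> by (simp add: P_eq Q_eq integral_distr)
    also have "\<dots> \<le> (\<integral>w. norm (Z w) \<partial>M)"
    proof (rule integral_abs_bound[THEN order_trans], rule integral_mono)
      show "\<bar>\<phi> (fst w - d) - \<phi> (snd w)\<bar> \<le> norm (Z w)" for w
        using lipschitz_onD[OF \<phi>(1), of "fst w - d" "snd w"]
        by (simp add: dist_norm Z_def algebra_simps)
    qed (use int_\<phi> int_Z in auto)
    finally have "((\<integral>u. \<phi> (u - d) \<partial>P) - (\<integral>v. \<phi> v \<partial>Q))\<^sup>2 \<le> (\<integral>w. norm (Z w) \<partial>M)\<^sup>2"
      by (metis abs_ge_zero power2_abs power_mono)
    \<comment> \<open>This is nonnegativity of the variance of |Z|.\<close>
    also have "\<dots> \<le> (\<integral>w. (norm (Z w))\<^sup>2 \<partial>M)"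
      using variance_positive[of "\<lambda>w. norm (Z w)"] int_Z int_Z2
      by (simp add: variance_eq)
    finally show ?thesis .
  qed
  ultimately have "(norm d)\<^sup>2 + ((\<integral>u. \<phi> (u - d) \<partial>P) - (\<integral>v. \<phi> v \<partial>Q))\<^sup>2
      \<le> (\<integral>w. (norm (fst w - snd w))\<^sup>2 \<partial>M)"
    by simp
  then show ?thesis
    using int_sq by (simp add: case_prod_unfold nn_integral_eq_integral ennreal_leI del: ennreal_plus)
qed

lemma ennreal_sqrt_mono_ennreal:
  assumes "0 \<le> r" "ennreal r \<le> a"
  shows "ennreal (sqrt r) \<le> ennreal_sqrt a"
  using assms by (cases a) (auto simp: ennreal_sqrt_def)

text \<open>The infimum in \<open>wasserstein2\<close> is over square roots of costs, so the bound
  is first taken through the root, then through the infimum, and squared at the end.\<close>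

lemma wasserstein2_sq_ge:
  assumes "0 \<le> r" "\<And>M. M \<in> couplings P Q \<Longrightarrow> ennreal r \<le> (\<integral>\<^sup>+ (u, v). ennreal ((norm (u - v))\<^sup>2) \<partial>M)"
  shows "ennreal r \<le> (wasserstein2 P Q)\<^sup>2"
proof -
  have "ennreal (sqrt r) \<le> wasserstein2 P Q"
    unfolding wasserstein2_def using assms by (intro INF_greatest ennreal_sqrt_mono_ennreal)
  then have "(ennreal (sqrt r))\<^sup>2 \<le> (wasserstein2 P Q)\<^sup>2"
    by (rule power_mono) simp
  then show ?thesis
    using assms(1) by (simp add: ennreal_power)
qed

text \<open>Driving both coordinates by the same \<open>z\<close> gives a coupling whose difference
  is constantly \<open>a - b\<close>.\<close>

lemma wasserstein2_translates_le:
  fixes P :: "'a::euclidean_space measure"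
  assumes P: "prob_space P" "sets P = sets borel"
  shows "(wasserstein2 (distr P borel (\<lambda>z. z + a)) (distr P borel (\<lambda>z. z + b)))\<^sup>2
    \<le> ennreal ((norm (a - b))\<^sup>2)"
proof -
  interpret prob_space P by fact
  have [measurable_cong]: "sets P = sets borel" by fact
  define M where "M = distr P (borel \<Otimes>\<^sub>M borel) (\<lambda>z. (z + a, z + b))"
  have "M \<in> couplings (distr P borel (\<lambda>z. z + a)) (distr P borel (\<lambda>z. z + b))"
    unfolding couplings_def M_def by (auto intro!: prob_space_distr simp: distr_distr comp_def)
  moreover have "(\<integral>\<^sup>+ (u, v). ennreal ((norm (u - v))\<^sup>2) \<partial>M) = ennreal ((norm (a - b))\<^sup>2)"
    unfolding M_def by (subst nn_integral_distr) (auto simp: emeasure_space_1)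
  ultimately have "wasserstein2 (distr P borel (\<lambda>z. z + a)) (distr P borel (\<lambda>z. z + b))
      \<le> ennreal_sqrt (ennreal ((norm (a - b))\<^sup>2))"
    unfolding wasserstein2_def by (metis (no_types, lifting) INF_lower)
  also have "\<dots> = ennreal (norm (a - b))"
    by (simp add: ennreal_sqrt_def)
  finally have "(wasserstein2 (distr P borel (\<lambda>z. z + a)) (distr P borel (\<lambda>z. z + b)))\<^sup>2
      \<le> (ennreal (norm (a - b)))\<^sup>2"
    by (rule power_mono) simp
  then show ?thesis
    by (simp add: ennreal_power)
qed

section \<open>Measures given by densities, and location families\<close>

lemma sets_dist_of [simp, measurable_cong]: "sets (dist_of g) = sets borel"
  by (simp add: dist_of_def)

lemma nn_integral_density_1: "is_density g \<Longrightarrow> (\<integral>\<^sup>+ z. ennreal (g z) \<partial>lborel) = 1"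
  by (simp add: is_density_def nn_integral_eq_integral)

lemma prob_space_dist_of:
  assumes "is_density g"
  shows "prob_space (dist_of g)"
  unfolding dist_of_def
  using assms nn_integral_density_1[OF assms]
  by (intro prob_spaceI) (simp add: emeasure_density is_density_def)

lemma
  fixes h :: "'a::euclidean_space \<Rightarrow> 'b::euclidean_space"
  assumes "is_density g" "h \<in> borel_measurable borel"
  shows integrable_dist_of: "integrable (dist_of g) h \<longleftrightarrow> integrable lborel (\<lambda>z. g z *\<^sub>R h z)"
    and integral_dist_of: "(\<integral>z. h z \<partial>dist_of g) = (\<integral>z. g z *\<^sub>R h z \<partial>lborel)"
  using assms unfolding dist_of_def
  by (auto simp: is_density_def integrable_density integral_density)

lemma dist_of_eq_iff:
  assumes "is_density g" "is_density h"
  shows "dist_of g = dist_of h \<longleftrightarrow> (AE z in lborel. g z = h z)"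
proof -
  have [measurable]: "g \<in> borel_measurable borel" "h \<in> borel_measurable borel"
    using assms by (auto simp: is_density_def)
  show ?thesis
    unfolding dist_of_def using assms
    by (subst sigma_finite_measure.density_unique_iff[OF sigma_finite_lborel])
       (auto simp: is_density_def)
qed

lemma dist_of_location_density:
  assumes "is_density f"
  shows "dist_of (location_density f \<mu>) = distr (dist_of f) borel (\<lambda>z. z + \<mu>)"
proof -
  have [measurable]: "f \<in> borel_measurable borel"
    using assms by (simp add: is_density_def)
  have "dist_of (location_density f \<mu>)
      = density (distr lborel borel ((+) \<mu>)) (\<lambda>z. ennreal (f (z - \<mu>)))"
    unfolding lborel_distr_plus dist_of_def location_density_def ..
  also have "\<dots> = distr (dist_of f) borel (\<lambda>z. z + \<mu>)"
    unfolding dist_of_def by (subst density_distr) (auto simp: add.commute[of _ \<mu>])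
  finally show ?thesis .
qed

lemma integral_dist_of_location_density:
  fixes h :: "'a::euclidean_space \<Rightarrow> 'b::euclidean_space"
  assumes "is_density f" "h \<in> borel_measurable borel"
  shows "(\<integral>u. h u \<partial>dist_of (location_density f a)) = (\<integral>z. h (z + a) \<partial>dist_of f)"
  unfolding dist_of_location_density[OF assms(1)] by (rule integral_distr[OF _ assms(2)]) measurable

text \<open>The second identity is translation invariance. The first integrates over the parameter
  and also uses the reflection of Lebesgue measure; it is the weight inserted in the Fubini argument
  for null sets.\<close>

lemma nn_integral_location_density:
  assumes "is_density f"
  shows "(\<integral>\<^sup>+ \<mu>. ennreal (location_density f \<mu> x) \<partial>lborel) = 1"
    and "(\<integral>\<^sup>+ x. ennreal (location_density f \<mu> x) \<partial>lborel) = 1"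
proof -
  have [measurable]: "f \<in> borel_measurable borel"
    using assms by (simp add: is_density_def)
  have "(\<integral>\<^sup>+ \<mu>. ennreal (f \<mu>) \<partial>distr lborel borel (\<lambda>\<mu>. x - \<mu>)) = 1"
    using nn_integral_density_1[OF assms] lborel_affine[of "-1" x] by (simp add: density_1)
  then show "(\<integral>\<^sup>+ \<mu>. ennreal (location_density f \<mu> x) \<partial>lborel) = 1"
    by (subst (asm) nn_integral_distr) (auto simp: location_density_def)
  have "(\<integral>\<^sup>+ z. ennreal (f z) \<partial>distr lborel borel ((+) (- \<mu>))) = 1"
    unfolding lborel_distr_plus by (rule nn_integral_density_1[OF assms])
  then show "(\<integral>\<^sup>+ x. ennreal (location_density f \<mu> x) \<partial>lborel) = 1"
    by (subst (asm) nn_integral_distr) (auto simp: location_density_def)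
qed

lemma is_density_location_density:
  assumes "is_density f"
  shows "is_density (location_density f \<mu>)"
proof -
  have "f \<in> borel_measurable borel" "0 \<le> f z" for z
    using assms by (auto simp: is_density_def)
  then have "integrable lborel (location_density f \<mu>) \<and> (LINT z|lborel. location_density f \<mu> z) = 1"
    using nn_integral_location_density(2)[OF assms, of \<mu>]
    by (subst nn_integral_eq_integrable[symmetric]) (auto simp: location_density_def[abs_def])
  with \<open>f \<in> borel_measurable borel\<close> \<open>\<And>z. 0 \<le> f z\<close> show ?thesis
    by (auto simp: is_density_def location_density_def[abs_def])
qed

text \<open>Joint measurability of \<open>p\<close> makes the parametrised integral measurable in
  \<open>x\<close>. With \<open>h\<close> the identity this covers the predictive mean, with
  \<open>h\<close> a test function the terms of the gap.\<close>

lemma predictive_density_integral_measurable: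
  fixes p :: "'a::euclidean_space \<Rightarrow> 'a \<Rightarrow> real" and h :: "'a \<Rightarrow> 'b::euclidean_space"
  assumes p: "predictive_density p" and [measurable]: "h \<in> borel_measurable borel"
  shows "(\<lambda>x. \<integral>y. h y \<partial>dist_of (p x)) \<in> borel_measurable borel"
proof -
  have [measurable]: "case_prod p \<in> borel_measurable (borel \<Otimes>\<^sub>M borel)"
    and dens: "is_density (p x)" for x
    using p by (auto simp: predictive_density_def)
  have "(\<lambda>x. \<integral>y. p x y *\<^sub>R h y \<partial>lborel) \<in> borel_measurable borel"
    by measurable
  then show ?thesis
    using dens by (simp add: integral_dist_of)
qed

lemma predictive_density_plug_in:
  assumes f: "is_density f" and p: "predictive_density p"
  shows "predictive_density (plug_in f p)"
proof -
  have [measurable]: "f \<in> borel_measurable borel"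
    using f by (simp add: is_density_def)
  have [measurable]: "(\<lambda>x. density_mean (p x)) \<in> borel_measurable borel"
    using predictive_density_integral_measurable[OF p, of "\<lambda>y. y"] p
    by (simp add: density_mean_def integral_dist_of predictive_density_def)
  show ?thesis
    unfolding predictive_density_def
    using is_density_location_density[OF f]
    by (auto simp: plug_in_def[abs_def] location_density_def[abs_def])
qed

text \<open>On a probability space |z| is dominated by the integrable function 1 + |z|^2.\<close>

lemma integrable_id_of_second_moment:
  assumes "is_density f" "integrable lborel (\<lambda>z. f z * (norm z)\<^sup>2)"
  shows "integrable (dist_of f) (\<lambda>z. z)"
proof -
  interpret prob_space "dist_of f"
    by (rule prob_space_dist_of[OF assms(1)])
  have "integrable (dist_of f) (\<lambda>z. (norm z)\<^sup>2)"
    using assms by (simp add: integrable_dist_of)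
  then have "integrable (dist_of f) (\<lambda>z. 1 + (norm z)\<^sup>2)"
    by simp
  then show ?thesis
  proof (rule Bochner_Integration.integrable_bound)
    show "AE z in dist_of f. norm z \<le> norm (1 + (norm z)\<^sup>2)"
    proof (rule AE_I2)
      fix z :: 'a
      have "0 \<le> (norm z - 1)\<^sup>2" by simp
      then have "2 * norm z \<le> 1 + (norm z)\<^sup>2"
        by (simp add: power2_eq_square algebra_simps)
      then show "norm z \<le> norm (1 + (norm z)\<^sup>2)"
        using norm_ge_zero[of z] unfolding real_norm_def by linarith
    qed
  qed auto
qed

section \<open>Two-sided control of the loss in a location family\<close>

text \<open>This is the shape defect of \<open>p x\<close>, seen through one test function, once its
  mean has been matched. It does not depend on the true parameter, so a single gap serves for every
  \<mu>.\<close>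

definition test_gap :: "('a::euclidean_space \<Rightarrow> real) \<Rightarrow> ('a \<Rightarrow> 'a \<Rightarrow> real) \<Rightarrow> ('a \<Rightarrow> real) \<Rightarrow> 'a \<Rightarrow> real"
  where "test_gap f p \<phi> x = (\<integral>y. \<phi> y \<partial>dist_of (plug_in f p x)) - (\<integral>y. \<phi> y \<partial>dist_of (p x))"

lemma wasserstein2_sq_location_ge:
  fixes f :: "'a::euclidean_space \<Rightarrow> real"
  assumes f: "is_density f" "density_mean f = 0" "integrable lborel (\<lambda>z. f z * (norm z)\<^sup>2)"
    and p: "is_density (p x)" "has_finite_mean (p x)"
    and \<phi>: "1-lipschitz_on UNIV \<phi>" "bounded (range \<phi>)"
  shows "ennreal ((norm (\<mu> - density_mean (p x)))\<^sup>2 + (test_gap f p \<phi> x)\<^sup>2)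
    \<le> (wasserstein2 (dist_of (location_density f \<mu>)) (dist_of (p x)))\<^sup>2"
proof (rule wasserstein2_sq_ge)
  fix M assume M: "M \<in> couplings (dist_of (location_density f \<mu>)) (dist_of (p x))"
  interpret prob_space "dist_of f"
    by (rule prob_space_dist_of[OF f(1)])
  have \<phi>m[measurable]: "\<phi> \<in> borel_measurable borel"
    using lipschitz_on_continuous_on[OF \<phi>(1)] by (rule borel_measurable_continuous_onI)
  have \<phi>m': "(\<lambda>u. \<phi> (u - c)) \<in> borel_measurable borel" for c
    by measurable
  have int: "integrable (dist_of f) (\<lambda>z. z)"
    using f by (intro integrable_id_of_second_moment)
  have id: "(\<lambda>u::'a. u) \<in> borel_measurable borel"
    by measurable
  have int_P: "integrable (dist_of (location_density f \<mu>)) (\<lambda>u. u)"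
    unfolding dist_of_location_density[OF f(1)]
    by (rule integrable_distr_eq[THEN iffD2]) (simp_all add: int)
  have int_Q: "integrable (dist_of (p x)) (\<lambda>v. v)"
    using p by (simp add: integrable_dist_of has_finite_mean_def)
  have "(\<integral>z. z \<partial>dist_of f) = 0"
    using f by (simp add: integral_dist_of density_mean_def)
  then have "(\<integral>z. z + \<mu> \<partial>dist_of f) = \<mu>"
    by (simp add: Bochner_Integration.integral_add int prob_space)
  then have "(\<integral>u. u \<partial>dist_of (location_density f \<mu>)) = \<mu>"
    unfolding integral_dist_of_location_density[OF f(1) id] .
  moreover have "(\<integral>v. v \<partial>dist_of (p x)) = density_mean (p x)"
    using p by (simp add: integral_dist_of density_mean_def)
  \<comment> \<open>Shifting the true distribution by the difference of the means yields exactly the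
    plug-in distribution, so \<mu> cancels.\<close>
  moreover have "(\<integral>u. \<phi> (u - (\<mu> - density_mean (p x))) \<partial>dist_of (location_density f \<mu>))
      = (\<integral>y. \<phi> y \<partial>dist_of (plug_in f p x))"
    unfolding plug_in_def integral_dist_of_location_density[OF f(1) \<phi>m]
      integral_dist_of_location_density[OF f(1) \<phi>m'] by (simp add: algebra_simps)
  ultimately show "ennreal ((norm (\<mu> - density_mean (p x)))\<^sup>2 + (test_gap f p \<phi> x)\<^sup>2)
      \<le> (\<integral>\<^sup>+ (u, v). ennreal ((norm (u - v))\<^sup>2) \<partial>M)"
    using coupling_cost_lower_bound[OF M int_P int_Q \<phi>] by (simp add: test_gap_def)
qed simp

text \<open>The true and the plug-in distribution are translates of the same measure, by \<mu> and
  by the predictive mean.\<close>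

lemma wasserstein2_sq_plug_in_le:
  assumes "is_density f"
  shows "(wasserstein2 (dist_of (location_density f \<mu>)) (dist_of (plug_in f p x)))\<^sup>2
    \<le> ennreal ((norm (\<mu> - density_mean (p x)))\<^sup>2)"
  unfolding plug_in_def dist_of_location_density[OF assms]
  using prob_space_dist_of[OF assms] by (rule wasserstein2_translates_le) simp

text \<open>By Fubini, the Lebesgue measure of the exceptional set is the integral over \<mu> of its
  probability under \<mu>. In contrapositive form this yields a parameter that charges a given set
  of positive Lebesgue measure.\<close>

lemma AE_location_density_imp_AE_lborel:
  assumes f: "is_density f" and [measurable]: "Measurable.pred borel R"
    and AE: "\<And>\<mu>. AE x in dist_of (location_density f \<mu>). R x"
  shows "AE x in lborel. R x"
proof -
  have [measurable]: "f \<in> borel_measurable borel"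
    using f by (simp add: is_density_def)
  have *: "(\<integral>\<^sup>+ x. ennreal (f (x - \<mu>)) * indicator {x. \<not> R x} x \<partial>lborel) = 0" for \<mu>
    using AE[of \<mu>] unfolding dist_of_def location_density_def
    by (subst nn_integral_0_iff_AE) (auto simp: AE_density not_less ennreal_neg elim!: eventually_mono split: split_indicator)
  \<comment> \<open>The constant 1 is inserted as the integral of the location density over its
    parameter.\<close>
  have "(\<integral>\<^sup>+ x. indicator {x. \<not> R x} x \<partial>lborel)
      = (\<integral>\<^sup>+ x. (\<integral>\<^sup>+ \<mu>. ennreal (location_density f \<mu> x) \<partial>lborel) * indicator {x. \<not> R x} x \<partial>lborel)"
    using nn_integral_location_density(1)[OF f] by simp
  also have "\<dots> = (\<integral>\<^sup>+ x. (\<integral>\<^sup>+ \<mu>. ennreal (f (x - \<mu>)) * indicator {x. \<not> R x} x \<partial>lborel) \<partial>lborel)"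
    by (simp add: nn_integral_multc location_density_def)
  also have "\<dots> = (\<integral>\<^sup>+ \<mu>. (\<integral>\<^sup>+ x. ennreal (f (x - \<mu>)) * indicator {x. \<not> R x} x \<partial>lborel) \<partial>lborel)"
    by (rule lborel_pair.Fubini') measurable
  also have "\<dots> = 0"
    by (simp add: *)
  finally have "(\<integral>\<^sup>+ x. indicator {x. \<not> R x} x \<partial>lborel) = 0" .
  then have "AE x in lborel. indicator {x. \<not> R x} x = (0::ennreal)"
    by (subst (asm) nn_integral_0_iff_AE) auto
  then show ?thesis
    by eventually_elim (auto split: split_indicator_asm)
qed

text \<open>The two strict clauses differ in how \<mu> arises. Under the Lebesgue condition it comes
  from the Fubini argument and cannot be prescribed, hence finite risk at every \<mu>; in the last
  clause one given \<mu> satisfies both conditions.\<close>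

theorem proposition3p1:
  fixes f :: "'a::euclidean_space \<Rightarrow> real" and phat :: "'a \<Rightarrow> 'a \<Rightarrow> real"
  assumes "is_density f"
    and "density_mean f = 0"
    and "integrable lborel (\<lambda>z. f z * (norm z)\<^sup>2)"
    and "predictive_density phat"
    and "\<And>x. has_finite_mean (phat x)"
  shows "(\<forall>\<mu>. risk f \<mu> (plug_in f phat) \<le> risk f \<mu> phat) \<and>
    ((\<forall>\<mu>. risk f \<mu> (plug_in f phat) < \<top>) \<and> \<not> coincide lborel phat (plug_in f phat)
       \<longrightarrow> dominates f (plug_in f phat) phat) \<and>
    ((\<exists>\<mu>. risk f \<mu> (plug_in f phat) < \<top> \<and>
           \<not> coincide (dist_of (location_density f \<mu>)) phat (plug_in f phat))
       \<longrightarrow> dominates f (plug_in f phat) phat)"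
proof -
  have plug: "predictive_density (plug_in f phat)"
    using assms by (intro predictive_density_plug_in)
  have dens: "is_density (phat x)" "is_density (plug_in f phat x)" for x
    using assms(4) plug by (auto simp: predictive_density_def)
  have [measurable]: "f \<in> borel_measurable borel"
    using assms(1) by (simp add: is_density_def)
  have [measurable]: "(\<lambda>x. density_mean (phat x)) \<in> borel_measurable borel"
    using predictive_density_integral_measurable[OF assms(4), of "\<lambda>y. y"] dens(1)
    by (simp add: density_mean_def integral_dist_of)
  \<comment> \<open>The squared-error risk of the predictive mean as a point estimator of \<mu> lies
    between the two risks to be compared.\<close>
  define mean_risk where
    "mean_risk \<mu> = (\<integral>\<^sup>+ x. ennreal ((norm (\<mu> - density_mean (phat x)))\<^sup>2)
      * ennreal (location_density f \<mu> x) \<partial>lborel)" for \<mu>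
  have plug_le: "risk f \<mu> (plug_in f phat) \<le> mean_risk \<mu>" for \<mu>
    unfolding risk_def mean_risk_def
    by (intro nn_integral_mono mult_right_mono wasserstein2_sq_plug_in_le assms) simp
  have gap_measurable: "test_gap f phat \<phi> \<in> borel_measurable borel" if "1-lipschitz_on UNIV \<phi>" for \<phi>
  proof -
    have [measurable]: "\<phi> \<in> borel_measurable borel"
      using lipschitz_on_continuous_on[OF that] by (rule borel_measurable_continuous_onI)
    show ?thesis
      unfolding test_gap_def[abs_def]
      by (intro borel_measurable_diff predictive_density_integral_measurable plug assms) auto
  qed
  \<comment> \<open>The integral is split only for the measurable lower bound; the risk itself
    enters by monotonicity.\<close>
  have risk_ge: "mean_risk \<mu> + (\<integral>\<^sup>+ x. ennreal ((test_gap f phat \<phi> x)\<^sup>2)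
      * ennreal (location_density f \<mu> x) \<partial>lborel) \<le> risk f \<mu> phat"
    if \<phi>: "1-lipschitz_on UNIV \<phi>" "bounded (range \<phi>)" for \<mu> \<phi>
  proof -
    have [measurable]: "test_gap f phat \<phi> \<in> borel_measurable borel"
      using \<phi>(1) by (rule gap_measurable)
    have "mean_risk \<mu> + (\<integral>\<^sup>+ x. ennreal ((test_gap f phat \<phi> x)\<^sup>2)
        * ennreal (location_density f \<mu> x) \<partial>lborel)
      = (\<integral>\<^sup>+ x. ennreal ((norm (\<mu> - density_mean (phat x)))\<^sup>2 + (test_gap f phat \<phi> x)\<^sup>2)
          * ennreal (location_density f \<mu> x) \<partial>lborel)"
      unfolding mean_risk_def
      by (subst nn_integral_add[symmetric]) (auto simp: location_density_def[abs_def] distrib_right)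
    also have "\<dots> \<le> risk f \<mu> phat"
      unfolding risk_def using assms dens \<phi>
      by (intro nn_integral_mono mult_right_mono wasserstein2_sq_location_ge) auto
    finally show ?thesis .
  qed
  have le: "risk f \<mu> (plug_in f phat) \<le> risk f \<mu> phat" for \<mu>
  proof -
    \<comment> \<open>The zero test function has no gap and leaves the plain inequality.\<close>
    have "1-lipschitz_on UNIV (\<lambda>x::'a. 0::real)" "bounded (range (\<lambda>x::'a. 0::real))"
      by (auto intro!: lipschitz_onI)
    from risk_ge[OF this, of \<mu>] plug_le[of \<mu>] show ?thesis
      by (simp add: test_gap_def)
  qed
  have strict: "risk f \<mu> (plug_in f phat) < risk f \<mu> phat"
    if fin: "risk f \<mu> (plug_in f phat) < \<top>" and \<phi>: "1-lipschitz_on UNIV \<phi>" "bounded (range \<phi>)"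
      and gap: "\<not> (AE x in dist_of (location_density f \<mu>). test_gap f phat \<phi> x = 0)" for \<mu> \<phi>
  \<comment> \<open>Adding a positive gap term is strict only to a finite value. If
    \<open>mean_risk \<mu>\<close> is infinite, so is the risk of \<open>phat\<close>, and
    finiteness of the plug-in risk decides.\<close>
  proof (cases "mean_risk \<mu> = \<top>")
    case True
    then have "risk f \<mu> phat = \<top>"
      using risk_ge[OF \<phi>, of \<mu>] by (simp add: top_unique)
    then show ?thesis
      using fin by simp
  next
    case False
    have [measurable]: "test_gap f phat \<phi> \<in> borel_measurable borel"
      using \<phi>(1) by (rule gap_measurable)
    let ?G = "\<integral>\<^sup>+ x. ennreal ((test_gap f phat \<phi> x)\<^sup>2) * ennreal (location_density f \<mu> x) \<partial>lborel"
    have "?G \<noteq> 0"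
    proof
      assume "?G = 0"
      then have "AE x in lborel. ennreal ((test_gap f phat \<phi> x)\<^sup>2) * ennreal (location_density f \<mu> x) = 0"
        by (subst (asm) nn_integral_0_iff_AE) (auto simp: location_density_def[abs_def])
      then have "AE x in dist_of (location_density f \<mu>). test_gap f phat \<phi> x = 0"
        unfolding dist_of_def
        by (subst AE_density) (auto simp: location_density_def[abs_def] elim!: eventually_mono)
      with gap show False ..
    qed
    then have "mean_risk \<mu> < mean_risk \<mu> + ?G"
      using False ennreal_add_left_cancel_less[of "mean_risk \<mu>" 0 ?G] by (simp add: zero_less_iff_neq_zero)
    then show ?thesis
      using plug_le[of \<mu>] risk_ge[OF \<phi>, of \<mu>] by order
  qed
  obtain F :: "('a \<Rightarrow> real) set" where F: "countable F"
    "\<And>\<phi>. \<phi> \<in> F \<Longrightarrow> 1-lipschitz_on UNIV \<phi>" "\<And>\<phi>. \<phi> \<in> F \<Longrightarrow> bounded (range \<phi>)"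
    "\<And>P Q. prob_space P \<Longrightarrow> prob_space Q \<Longrightarrow> sets P = sets borel \<Longrightarrow> sets Q = sets borel \<Longrightarrow>
      (\<And>\<phi>. \<phi> \<in> F \<Longrightarrow> (\<integral>x. \<phi> x \<partial>P) = (\<integral>x. \<phi> x \<partial>Q)) \<Longrightarrow> P = Q"
    by (rule countable_lipschitz_family_determines_prob) blast
  have gap_ex: "\<exists>\<phi>\<in>F. \<not> (AE x in M. test_gap f phat \<phi> x = 0)"
    if "\<not> coincide M phat (plug_in f phat)" for M
  proof (rule ccontr)
    assume "\<not> ?thesis"
    \<comment> \<open>Here countability of \<open>F\<close> is used: off one null set all gaps
      vanish together, and the two distributions agree.\<close>
    then have "AE x in M. \<forall>\<phi>\<in>F. test_gap f phat \<phi> x = 0"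
      using F(1) by (simp add: AE_ball_countable)
    then have "coincide M phat (plug_in f phat)"
      unfolding coincide_def
    proof eventually_elim
      case (elim x)
      then have "dist_of (phat x) = dist_of (plug_in f phat x)"
        using dens[of x] by (intro F(4)) (auto simp: prob_space_dist_of test_gap_def)
      then show ?case
        using dens[of x] by (simp add: dist_of_eq_iff)
    qed
    with that show False ..
  qed
  have dom: "dominates f (plug_in f phat) phat"
    if "risk f \<mu> (plug_in f phat) < \<top>" "\<phi> \<in> F"
      "\<not> (AE x in dist_of (location_density f \<mu>). test_gap f phat \<phi> x = 0)" for \<mu> \<phi>
    using le strict[OF that(1) F(2,3)[OF that(2)] that(3)] unfolding dominates_def by blast
  have "dominates f (plug_in f phat) phat"
    if fin: "\<And>\<mu>. risk f \<mu> (plug_in f phat) < \<top>" and nc: "\<not> coincide lborel phat (plug_in f phat)"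
  proof -
    obtain \<phi> where \<phi>: "\<phi> \<in> F" "\<not> (AE x in lborel. test_gap f phat \<phi> x = 0)"
      using gap_ex[OF nc] by blast
    have [measurable]: "test_gap f phat \<phi> \<in> borel_measurable borel"
      using F(2)[OF \<phi>(1)] by (rule gap_measurable)
    have "Measurable.pred borel (\<lambda>x. test_gap f phat \<phi> x = 0)"
      by measurable
    \<comment> \<open>A gap that is not Lebesgue-null must be visible under some translate of
      \<open>f\<close>.\<close>
    then obtain \<mu> where "\<not> (AE x in dist_of (location_density f \<mu>). test_gap f phat \<phi> x = 0)"
      using AE_location_density_imp_AE_lborel[OF assms(1)] \<phi>(2) by blast
    then show ?thesis
      using dom[OF fin \<phi>(1)] by blast
  qed
  moreover have "dominates f (plug_in f phat) phat"
    if "risk f \<mu> (plug_in f phat) < \<top>"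
      "\<not> coincide (dist_of (location_density f \<mu>)) phat (plug_in f phat)" for \<mu>
    using gap_ex[OF that(2)] dom[OF that(1)] by blast
  ultimately show ?thesis
    using le by blast
qed

end
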